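(* Let $k\ge 2$, $c$ and $n$ be integers with $n\ge 1$. Let $f(x)=ax+b\in\mathbb{Z}[x]$ with $\gcd(a,n)=1$. Then $$\mathcal{N}_{k,f,c}(n)=n^{k-1}\prod_{p\mid n}\frac{(p-1)^k+(-1)^k\delta_p}{p^k},$$ where the product runs over the distinct prime divisors $p$ of $n$ and $$\delta_p=\begin{cases} p-1, & \text{if } p\mid (ac+kb),\\ -1, & \text{if } p\nmid (ac+kb).\end{cases}$$
   Context: For a positive integer $n$, $\mathbb{Z}_n=\{0,1,\dots,n-1\}$ denotes the ring of residue classes modulo $n$. For $f(x)\in\mathbb{Z}[x]$, let $E_f(n)=\{a\in\mathbb{Z}_n:\gcd(f(a),n)=1\}$ (the $f$-exunits in $\mathbb{Z}_n$), and $$\mathcal{N}_{k,f,c}(n)=\#\{(x_1,\dots,x_k)\in E_f(n)^k: x_1+\cdots+x_k\equiv c\pmod n\}.$$ *)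

theory Defs
  imports
    Complex_Main
    "HOL-Library.FuncSet"
    "HOL-Computational_Algebra.Polynomial"
    "HOL-Computational_Algebra.Primes"
    "HOL-Number_Theory.Cong"
begin

(* The residue ring modulo n is represented by the integers 0, ..., n - 1. *)
definition exunits :: "int poly \<Rightarrow> nat \<Rightarrow> int set" where
  "exunits f n = {a \<in> {0..<int n}. gcd (poly f a) (int n) = 1}"

(* A k-tuple is an extensional function on {1..k}, so distinct elements of the
   counted set are distinct tuples. *)
definition num_exunit_reps :: "nat \<Rightarrow> int poly \<Rightarrow> int \<Rightarrow> nat \<Rightarrow> nat" where
  "num_exunit_reps k f c n =
     card {x \<in> {1..k} \<rightarrow>\<^sub>E exunits f n. [(\<Sum>i=1..k. x i) = c] (mod int n)}"

definition delta :: "nat \<Rightarrow> int \<Rightarrow> int \<Rightarrow> int \<Rightarrow> nat \<Rightarrow> int" where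
  "delta k a b c p = (if int p dvd a * c + int k * b then int p - 1 else - 1)"

end

theory Submission
  imports Defs
begin

text \<open>
  Fixing the last coordinate gives \<open>N\<^sub>k\<^sub>+\<^sub>1(c) = \<Sum>\<^sub>x N\<^sub>k(c - x)\<close> over the exunits \<open>x\<close>. If the product formula holds
  for \<open>k\<close>, the right-hand side is a sum over all residues modulo \<open>n\<close> of a product of functions, one for each
  prime \<open>p\<close> dividing \<open>n\<close> and periodic modulo \<open>p\<close>; by the Chinese remainder theorem such a sum splits into a
  product of sums modulo \<open>p\<close>. The latter are elementary because \<open>\<delta>\<^sub>p\<close>, as a function of \<open>a c + k b\<close> modulo \<open>p\<close>,
  has mean zero. The formula already holds for \<open>k = 1\<close>, where the induction starts.
\<close>

section \<open>Periodic functions and their sums over residues\<close>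

definition periodic_mod :: "nat \<Rightarrow> (int \<Rightarrow> 'a) \<Rightarrow> bool" where
  "periodic_mod m h \<longleftrightarrow> (\<forall>x y. [x = y] (mod int m) \<longrightarrow> h x = h y)"

lemma periodic_modD: "periodic_mod m h \<Longrightarrow> [x = y] (mod int m) \<Longrightarrow> h x = h y"
  unfolding periodic_mod_def by blast

lemma periodic_mod_dvd: "periodic_mod m h \<Longrightarrow> m dvd n \<Longrightarrow> periodic_mod n h"
  unfolding periodic_mod_def by (meson cong_dvd_modulus int_dvd_int_iff)

lemma periodic_mod_prod:
  assumes "\<And>p. p \<in> P \<Longrightarrow> periodic_mod m (h p)"
  shows "periodic_mod m (\<lambda>x. \<Prod>p\<in>P. h p x)"
  unfolding periodic_mod_def
  by (intro allI impI prod.cong refl) (rule periodic_modD[OF assms])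

lemma bij_betw_affine_mod:
  fixes a b :: int and m :: nat
  assumes "m > 0" "coprime a (int m)"
  shows "bij_betw (\<lambda>x. nat ((a * int x + b) mod int m)) {..<m} {..<m}"
proof -
  let ?f = "\<lambda>x. nat ((a * int x + b) mod int m)"
  have inj: "inj_on ?f {..<m}"
  proof (rule inj_onI)
    fix x y assume xy: "x \<in> {..<m}" "y \<in> {..<m}" "?f x = ?f y"
    have "[a * int x + b = a * int y + b] (mod int m)"
      using xy(3) assms(1) by (simp add: cong_def eq_nat_nat_iff)
    then have "[int x = int y] (mod int m)"
      using assms(2) by (metis cong_add_rcancel cong_mult_lcancel)
    then show "x = y" using xy(1,2)
      by (simp add: cong_def)
  qed
  \<comment> \<open>An injective self-map of a finite set is onto.\<close>
  moreover have "?f ` {..<m} \<subseteq> {..<m}"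
    using assms(1) by (auto simp: nat_less_iff)
  ultimately show ?thesis
    by (simp add: bij_betw_def endo_inj_surj)
qed

lemma sum_affine_periodic:
  fixes a b :: int and h :: "int \<Rightarrow> 'a::comm_monoid_add"
  assumes "m > 0" "coprime a (int m)" "periodic_mod m h"
  shows "(\<Sum>x<m. h (a * int x + b)) = (\<Sum>x<m. h (int x))"
proof -
  have "(\<Sum>x<m. h (int x)) = (\<Sum>x<m. h (int (nat ((a * int x + b) mod int m))))"
    by (rule sum.reindex_bij_betw[OF bij_betw_affine_mod[OF assms(1,2)], symmetric])
  also have "\<dots> = (\<Sum>x<m. h (a * int x + b))"
    using assms(1) by (intro sum.cong refl periodic_modD[OF assms(3)]) (simp add: cong_def)
  finally show ?thesis by simp
qed

text \<open>Division with remainder \<open>u = i + q * j\<close>: the order of summation puts the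
  residue \<open>i\<close> outside, so functions of period \<open>q\<close> are constant on the
  inner sum.\<close>

lemma sum_lessThan_mult:
  fixes F :: "nat \<Rightarrow> 'a::comm_monoid_add"
  shows "(\<Sum>u<q * m. F u) = (\<Sum>i<q. \<Sum>j<m. F (i + q * j))"
proof -
  have "(\<Sum>u<q * m. F u) = (\<Sum>j<m. sum F {j * q..<j * q + q})"
    by (simp add: sum.nat_group mult.commute)
  also have "\<dots> = (\<Sum>j<m. \<Sum>i<q. F (i + q * j))"
  proof (rule sum.cong[OF refl])
    fix j
    show "sum F {j * q..<j * q + q} = (\<Sum>i<q. F (i + q * j))"
      using sum.shift_bounds_nat_ivl[of F 0 "j * q" q]
      by (simp add: atLeast0LessThan ac_simps)
  qed
  finally show ?thesis by (simp add: sum.swap[of _ "{..<m}"])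
qed

text \<open>Chinese remainder theorem for sums: at \<open>u = i + q * j\<close> the value of
  \<open>F\<close> depends on \<open>i\<close> only, while for fixed \<open>i\<close> the argument
  of \<open>g\<close> runs through all residues modulo \<open>m\<close>, because \<open>q\<close> is
  invertible there.\<close>

lemma sum_mult_periodic:
  fixes F g :: "int \<Rightarrow> 'a::comm_semiring_1"
  assumes "m > 0" "coprime q m" "periodic_mod q F" "periodic_mod m g"
  shows "(\<Sum>u<q * m. F (int u) * g (int u)) = (\<Sum>u<q. F (int u)) * (\<Sum>u<m. g (int u))"
proof -
  have F: "F (int i + int q * int j) = F (int i)" for i j
    by (rule periodic_modD[OF assms(3)]) (simp add: cong_def)
  have g: "(\<Sum>j<m. g (int i + int q * int j)) = (\<Sum>u<m. g (int u))" for i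
    using sum_affine_periodic[OF assms(1) _ assms(4), of "int q" "int i"] assms(2)
    by (simp add: add.commute)
  have "(\<Sum>u<q * m. F (int u) * g (int u)) =
      (\<Sum>i<q. F (int i) * (\<Sum>j<m. g (int i + int q * int j)))"
    by (simp add: sum_lessThan_mult F sum_distrib_left)
  then show ?thesis by (simp add: g sum_distrib_right)
qed

text \<open>A new prime is coprime to the product of the earlier ones, which is a period of the
  product of their functions, so \<open>sum_mult_periodic\<close> splits it off.\<close>

lemma sum_prod_periodic:
  fixes h :: "nat \<Rightarrow> int \<Rightarrow> 'a::comm_semiring_1"
  assumes "finite P" "\<And>p. p \<in> P \<Longrightarrow> prime p" "\<And>p. p \<in> P \<Longrightarrow> periodic_mod p (h p)"
  shows "(\<Sum>u<\<Prod>P. \<Prod>p\<in>P. h p (int u)) = (\<Prod>p\<in>P. \<Sum>u<p. h p (int u))"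
  using assms
proof (induction P rule: finite_induct)
  case empty
  then show ?case by (simp add: lessThan_Suc)
next
  case (insert p P)
  have "coprime (\<Prod>P) p"
    using insert.prems(1) insert.hyps(2)
    by (intro prod_coprime_left) (metis insertCI primes_coprime)
  moreover have "periodic_mod (\<Prod>P) (\<lambda>x. \<Prod>p\<in>P. h p x)"
    using insert.prems(2) insert.hyps(1)
    by (intro periodic_mod_prod) (auto intro: periodic_mod_dvd dvd_prodI)
  moreover have "p > 0" using insert.prems(1) prime_gt_0_nat by blast
  ultimately show ?case
    using insert sum_mult_periodic[of p "\<Prod>P" "\<lambda>x. \<Prod>p\<in>P. h p x" "h p"]
    by (simp add: mult.commute)
qed

text \<open>The summand already has period \<open>\<Prod>?P\<close>, the radical of
  \<open>n\<close>, so the sum over \<open>n\<close> consists of \<open>n / \<Prod>?P\<close> equal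
  blocks; the denominator is then spread over the primes as \<open>1 / p\<close> each.\<close>

lemma sum_prod_periodic_multiple:
  fixes h :: "nat \<Rightarrow> int \<Rightarrow> real"
  assumes "n > 0"
    and "\<And>p. prime p \<Longrightarrow> p dvd n \<Longrightarrow> periodic_mod p (h p)"
  shows "(\<Sum>u<n. \<Prod>p | prime p \<and> p dvd n. h p (int u)) =
    real n * (\<Prod>p | prime p \<and> p dvd n. (\<Sum>u<p. h p (int u)) / real p)"
proof -
  let ?P = "{p. prime p \<and> p dvd n}"
  have fin: "finite ?P" using assms(1) by simp
  \<comment> \<open>Divisibility by each of several pairwise coprime primes gives divisibility by
    their product.\<close>
  have "[n = 0] (mod \<Prod>?P)"
    by (rule cong_cong_prod_coprime_nat) (auto simp: cong_0_iff primes_coprime)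
  then have "\<Prod>?P dvd n" by (simp add: cong_0_iff)
  then obtain m where m: "n = \<Prod>?P * m" ..
  have pos: "\<Prod>?P > 0"
    using assms(1) m by (metis mult_zero_left neq0_conv)
  define F where "F x = (\<Prod>p\<in>?P. h p x)" for x
  have F: "periodic_mod (\<Prod>?P) F"
    unfolding F_def using assms(2) fin
    by (intro periodic_mod_prod) (auto intro: periodic_mod_dvd dvd_prodI)
  have "(\<Sum>u<n. F (int u)) = (\<Sum>i<\<Prod>?P. \<Sum>j<m. F (int (i + \<Prod>?P * j)))"
    by (subst m) (rule sum_lessThan_mult)
  also have "\<dots> = (\<Sum>i<\<Prod>?P. \<Sum>j<m. F (int i))"
    by (intro sum.cong refl periodic_modD[OF F]) (simp add: cong_def)
  also have "\<dots> = real m * (\<Sum>i<\<Prod>?P. F (int i))"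
    by (simp add: sum_distrib_left)
  also have "(\<Sum>i<\<Prod>?P. F (int i)) = (\<Prod>p\<in>?P. \<Sum>u<p. h p (int u))"
    unfolding F_def using fin assms(2) by (intro sum_prod_periodic) auto
  also have "real m = real n / real (\<Prod>?P)"
    using arg_cong[OF m, of real] pos by (simp add: field_simps del: of_nat_prod)
  finally show ?thesis
    by (simp add: F_def prod_dividef)
qed

section \<open>Recursion for the number of representations\<close>

lemma finite_exunits: "finite (exunits f n)"
  unfolding exunits_def by (rule finite_subset[of _ "{0..<int n}"]) auto

lemma num_exunit_reps_0:
  "num_exunit_reps 0 f c n = (if int n dvd c then 1 else 0)"
  by (auto simp: num_exunit_reps_def cong_def dvd_eq_mod_eq_0)

lemma num_exunit_reps_Suc:
  "num_exunit_reps (Suc k) f c n = (\<Sum>y\<in>exunits f n. num_exunit_reps k f (c - y) n)"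
proof -
  let ?E = "exunits f n" and ?I = "{1..k}"
  let ?B = "\<lambda>y. {g \<in> ?I \<rightarrow>\<^sub>E ?E. [(\<Sum>i=1..k. g i) = c - y] (mod int n)}"
  let ?upd = "\<lambda>(y, g). g(Suc k := y)"
  have I: "{1..Suc k} = insert (Suc k) ?I" by auto
  have sum_upd: "(\<Sum>i=1..k. (g(Suc k := y)) i) = (\<Sum>i=1..k. g i)"
    for g :: "nat \<Rightarrow> int" and y
    by (rule sum.cong) auto
  \<comment> \<open>The new index lies outside \<open>?I\<close>, so both the last coordinate and
    the extensional tuple on \<open>?I\<close> can be recovered.\<close>
  have "inj_on ?upd (?E \<times> (?I \<rightarrow>\<^sub>E ?E))"
    using inj_combinator[of "Suc k" ?I "\<lambda>_. ?E"] by simp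
  then have inj: "inj_on ?upd (Sigma ?E ?B)"
    by (rule inj_on_subset) auto
  have cong: "[(\<Sum>i=1..Suc k. (g(Suc k := y)) i) = c] (mod int n) \<longleftrightarrow>
      [(\<Sum>i=1..k. g i) = c - y] (mod int n)" for g :: "nat \<Rightarrow> int" and y
    using sum_upd[of g y] by (simp add: cong_iff_dvd_diff algebra_simps)
  have "{x \<in> {1..Suc k} \<rightarrow>\<^sub>E ?E. [(\<Sum>i=1..Suc k. x i) = c] (mod int n)} = ?upd ` Sigma ?E ?B"
    unfolding I PiE_insert_eq using cong[unfolded I] by (auto simp: image_iff)
  then have "num_exunit_reps (Suc k) f c n = card (Sigma ?E ?B)"
    unfolding num_exunit_reps_def using card_image[OF inj] by simp
  also have "\<dots> = (\<Sum>y\<in>?E. card (?B y))"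
    by (rule card_SigmaI) (simp_all add: finite_exunits finite_PiE)
  finally show ?thesis by (simp add: num_exunit_reps_def)
qed

lemma gcd_eq_1_iff_no_prime:
  fixes z :: int and n :: nat
  assumes "n > 0"
  shows "gcd z (int n) = 1 \<longleftrightarrow> (\<forall>p. prime p \<and> p dvd n \<longrightarrow> \<not> int p dvd z)"
proof
  assume g: "gcd z (int n) = 1"
  show "\<forall>p. prime p \<and> p dvd n \<longrightarrow> \<not> int p dvd z"
  proof (intro allI impI notI)
    fix p assume p: "prime p \<and> p dvd n" "int p dvd z"
    then have "int p dvd gcd z (int n)" by simp
    then show False using p g by simp
  qed
next
  assume np: "\<forall>p. prime p \<and> p dvd n \<longrightarrow> \<not> int p dvd z"
  show "gcd z (int n) = 1"
  proof (rule ccontr)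
    assume "gcd z (int n) \<noteq> 1"
    then have "nat (gcd z (int n)) \<noteq> 1" by linarith
    then obtain p where p: "prime p" "p dvd nat (gcd z (int n))"
      using prime_factor_nat by blast
    then have "int p dvd gcd z (int n)"
      by (metis gcd_ge_0_int int_dvd_int_iff nat_0_le)
    then show False using np p(1) by auto
  qed
qed

text \<open>Makes the exunit condition a product of conditions at single primes, so that it can be
  merged with the product formula.\<close>

lemma prod_indicator_exunit:
  assumes "n > 0"
  shows "(\<Prod>p | prime p \<and> p dvd n. if int p dvd z then 0 else 1) =
    (if gcd z (int n) = 1 then 1 else (0::real))"
proof -
  have "finite {p. prime p \<and> p dvd n}" using assms by simp
  then show ?thesis
    by (auto simp: gcd_eq_1_iff_no_prime[OF assms] intro!: prod.neutral)
qed

lemma sum_exunits: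
  fixes G :: "int \<Rightarrow> real"
  assumes "n > 0"
  shows "(\<Sum>y\<in>exunits f n. G y) =
    (\<Sum>u<n. (\<Prod>p | prime p \<and> p dvd n. if int p dvd poly f (int u) then 0 else 1) * G (int u))"
proof -
  have "(\<Sum>y\<in>exunits f n. G y) =
      (\<Sum>y\<in>{0..<int n}. if gcd (poly f y) (int n) = 1 then G y else 0)"
    unfolding exunits_def by (intro sum.inter_filter) simp
  also have "\<dots> = (\<Sum>u<n. if gcd (poly f (int u)) (int n) = 1 then G (int u) else 0)"
    by (rule sum.reindex_bij_witness[of _ int nat]) auto
  finally show ?thesis
    by (simp only: prod_indicator_exunit[OF assms]) (auto intro!: sum.cong)
qed

section \<open>Summation of the local factors\<close>

text \<open>The local factor at \<open>p\<close>, as a function of the residue \<open>s = a c + k b\<close>.\<close>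

definition local_factor :: "nat \<Rightarrow> nat \<Rightarrow> int \<Rightarrow> real" where
  "local_factor k p s =
    ((real p - 1) ^ k + (- 1) ^ k * (if int p dvd s then real p - 1 else - 1)) / real p ^ k"

lemma cong_dvd_minus_iff:
  fixes x y s m :: int
  assumes "[x = y] (mod m)"
  shows "m dvd s - x \<longleftrightarrow> m dvd s - y"
  using cong_diff[OF cong_refl assms] by (rule cong_dvd_iff)

text \<open>The \<open>p - 1\<close> nonzero residues turn \<open>(p - 1) ^ k\<close> into
  \<open>(p - 1) ^ Suc k\<close>. As \<open>d\<close> has mean zero, leaving out
  \<open>u = 0\<close> yields \<open>- d s\<close>, which is the sign change from
  \<open>(- 1) ^ k\<close> to \<open>(- 1) ^ Suc k\<close>.\<close>

lemma sum_local_factor: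
  assumes "p > 1"
  shows "(\<Sum>u<p. (if int p dvd int u then 0 else 1) * local_factor k p (s - int u)) =
    real p * local_factor (Suc k) p s"
proof -
  define d :: "int \<Rightarrow> real" where "d t = (if int p dvd t then real p - 1 else - 1)" for t
  have per: "periodic_mod p (\<lambda>x. d (- x))"
    unfolding periodic_mod_def d_def by (simp add: cong_dvd_iff)
  have split: "{..<p} = insert 0 {1..<p}" using assms by auto
  have ndvd: "\<not> int p dvd int u" if "u \<in> {1..<p}" for u
    using that by (auto dest: dvd_imp_le)
  have "(\<Sum>u<p. d (s - int u)) = (\<Sum>u<p. d (- int u))"
    using sum_affine_periodic[of p 1 "\<lambda>x. d (- x)" "- s"] per assms by simp
  \<comment> \<open>The value \<open>p - 1\<close> occurs once, at \<open>u = 0\<close>, and cancels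
    the value \<open>- 1\<close> taken \<open>p - 1\<close> times.\<close>
  also have "\<dots> = 0"
    unfolding split using assms ndvd by (simp add: d_def of_nat_diff)
  finally have "d s + (\<Sum>u\<in>{1..<p}. d (s - int u)) = 0"
    by (simp add: split)
  then have sum_d: "(\<Sum>u\<in>{1..<p}. d (s - int u)) = - d s" by simp
  have lf: "local_factor k p t = ((real p - 1) ^ k + (- 1) ^ k * d t) / real p ^ k" for k t
    by (simp add: local_factor_def d_def)
  have "(\<Sum>u<p. (if int p dvd int u then 0 else 1) * local_factor k p (s - int u)) =
      (\<Sum>u\<in>{1..<p}. local_factor k p (s - int u))"
    unfolding split using ndvd by simp
  also have "\<dots> = ((real p - 1) ^ Suc k + (- 1) ^ k * (- d s)) / real p ^ k"
    unfolding lf sum_divide_distrib[symmetric] sum.distrib sum_distrib_left[symmetric] sum_d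
    using assms by (simp add: of_nat_diff)
  also have "\<dots> = real p * local_factor (Suc k) p s"
    using assms by (simp add: lf)
  finally show ?thesis .
qed

text \<open>Reduces to \<open>sum_local_factor\<close>, since \<open>a * u + b\<close> permutes the
  residues modulo \<open>p\<close>.\<close>

lemma sum_local_factor_affine:
  assumes "p > 1" "coprime a (int p)"
  shows "(\<Sum>u<p. (if int p dvd a * int u + b then 0 else 1) * local_factor k p (s - (a * int u + b))) =
    real p * local_factor (Suc k) p s"
proof -
  have "periodic_mod p (\<lambda>x. (if int p dvd x then 0 else 1) * local_factor k p (s - x))"
    unfolding periodic_mod_def local_factor_def
    by (auto simp: cong_dvd_minus_iff cong_dvd_iff)
  from sum_affine_periodic[OF _ assms(2) this, of b] show ?thesis
    unfolding sum_local_factor[OF assms(1)] using assms(1) by linarith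
qed

section \<open>Induction on the number of summands\<close>

lemma poly_cong:
  fixes x y m :: int
  assumes "[x = y] (mod m)"
  shows "[poly f x = poly f y] (mod m)"
  by (induction f) (simp_all add: cong_add cong_mult assms)

lemma num_exunit_reps_1:
  assumes "n > 0"
  shows "num_exunit_reps 1 f c n = (if gcd (poly f c) (int n) = 1 then 1 else 0)"
proof -
  have poly_mod: "[poly f (c mod int n) = poly f c] (mod int n)"
    by (rule poly_cong) (simp add: cong_def)
  have "num_exunit_reps 1 f c n = (\<Sum>y\<in>exunits f n. if int n dvd c - y then 1 else 0)"
    using num_exunit_reps_Suc[of 0] by (simp add: num_exunit_reps_0)
  \<comment> \<open>Exunits lie in \<open>{0..<int n}\<close>, so the only candidate is the reduced
    residue of \<open>c\<close>.\<close>
  also have "\<dots> = (\<Sum>y\<in>exunits f n. if y = c mod int n then 1 else 0)"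
    by (intro sum.cong refl) (auto simp: exunits_def mod_eq_dvd_iff[symmetric])
  also have "\<dots> = (if c mod int n \<in> exunits f n then 1 else 0)"
    using finite_exunits by simp
  also have "c mod int n \<in> exunits f n \<longleftrightarrow> gcd (poly f c) (int n) = 1"
    using assms cong_gcd_eq[OF poly_mod] by (simp add: exunits_def)
  finally show ?thesis by simp
qed

lemma num_exunit_reps_linear:
  fixes a b c :: int
  assumes "n > 0" "coprime a (int n)"
  shows "real (num_exunit_reps (Suc k) [:b, a:] c n) =
    real n ^ k * (\<Prod>p | prime p \<and> p dvd n. local_factor (Suc k) p (a * c + int (Suc k) * b))"
proof (induction k arbitrary: c)
  case 0
  \<comment> \<open>For one summand the numerator is \<open>(p - 1) - (p - 1) = 0\<close> or
    \<open>(p - 1) + 1 = p\<close>, so the local factor is an indicator.\<close>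
  have "(\<Prod>p | prime p \<and> p dvd n. local_factor 1 p (a * c + b)) =
      (\<Prod>p | prime p \<and> p dvd n. if int p dvd a * c + b then 0 else 1)"
    by (intro prod.cong refl) (auto simp: local_factor_def prime_gt_0_nat)
  then show ?case
    using num_exunit_reps_1[OF assms(1), of "[:b, a:]" c] prod_indicator_exunit[OF assms(1), of "a * c + b"]
    by (simp add: ac_simps)
next
  case (Suc k)
  let ?P = "{p. prime p \<and> p dvd n}"
  let ?s = "a * c + int (Suc (Suc k)) * b"
  let ?h = "\<lambda>p x. (if int p dvd a * x + b then 0 else 1) * local_factor (Suc k) p (?s - (a * x + b))"
  have per: "periodic_mod p (?h p)" for p
    unfolding periodic_mod_def
  proof (intro allI impI)
    fix x y assume "[x = y] (mod int p)"
    then have "[a * x + b = a * y + b] (mod int p)"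
      by (intro cong_add cong_mult cong_refl)
    then show "?h p x = ?h p y"
      by (simp only: local_factor_def cong_dvd_minus_iff cong_dvd_iff)
  qed
  have "real (num_exunit_reps (Suc (Suc k)) [:b, a:] c n) =
      (\<Sum>y\<in>exunits [:b, a:] n. real (num_exunit_reps (Suc k) [:b, a:] (c - y) n))"
    by (simp only: num_exunit_reps_Suc[of "Suc k"] of_nat_sum)
  \<comment> \<open>The parameter for \<open>c - y\<close> is
    \<open>a * (c - y) + Suc k * b = ?s - (a * y + b)\<close>: removing \<open>y\<close> subtracts
    the value of the polynomial at \<open>y\<close>.\<close>
  also have "\<dots> = (\<Sum>y\<in>exunits [:b, a:] n. real n ^ k *
      (\<Prod>p\<in>?P. local_factor (Suc k) p (?s - (a * y + b))))"
    unfolding Suc.IH by (simp add: algebra_simps)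
  also have "\<dots> = real n ^ k * (\<Sum>u<n. \<Prod>p\<in>?P. ?h p (int u))"
    unfolding sum_distrib_left[symmetric] sum_exunits[OF assms(1)]
    by (simp only: prod.distrib) (simp add: ac_simps)
  also have "\<dots> = real n ^ Suc k * (\<Prod>p\<in>?P. (\<Sum>u<p. ?h p (int u)) / real p)"
    using sum_prod_periodic_multiple[OF assms(1), of ?h, OF per] by simp
  also have "(\<Prod>p\<in>?P. (\<Sum>u<p. ?h p (int u)) / real p) = (\<Prod>p\<in>?P. local_factor (Suc (Suc k)) p ?s)"
  proof (rule prod.cong[OF refl])
    fix p assume p: "p \<in> ?P"
    then have "coprime a (int p)"
      using assms(2) by (auto intro: coprime_divisors[of a a "int p" "int n"])
    moreover have "p > 1" using p prime_gt_1_nat by blast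
    ultimately show "(\<Sum>u<p. ?h p (int u)) / real p = local_factor (Suc (Suc k)) p ?s"
      by (subst sum_local_factor_affine) auto
  qed
  finally show ?case .
qed

theorem theorem1p2:
  fixes k n :: nat and a b c :: int
  assumes "k \<ge> 2" and "n \<ge> 1" and "gcd a (int n) = 1"
  shows "real (num_exunit_reps k [:b, a:] c n) =
    real n ^ (k - 1) *
    (\<Prod>p | prime p \<and> p dvd n.
      ((real p - 1) ^ k + (- 1) ^ k * real_of_int (delta k a b c p)) / real p ^ k)"
proof -
  have "local_factor k p (a * c + int k * b) =
      ((real p - 1) ^ k + (- 1) ^ k * real_of_int (delta k a b c p)) / real p ^ k" for p
    by (simp add: local_factor_def delta_def)
  then show ?thesis
    \<comment> \<open>Instantiated at \<open>k - 1\<close>, where \<open>Suc (k - 1) = k\<close>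
      because \<open>k \<ge> 2\<close>.\<close>
    using num_exunit_reps_linear[of n a "k - 1" b c] assms
    by (simp add: coprime_iff_gcd_eq_1)
qed

end
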